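(* Let $m\geq 1$ be an integer, let $(S,\cdot,\leq)$ be an $m$-regular ordered semigroup and let $B$ be a subsemigroup of $S$. Then there exist an $m$-right ideal $R$ and an $m$-left ideal $L$ of $S$ with $B=(RL]$ if and only if $B$ is an $m$-bi-interior ideal of $S$.
   Context: An ordered semigroup $(S,\cdot,\leq)$ is a semigroup with a partial order such that $a\leq b$ implies $xa\leq xb$ and $ax\leq bx$ for all $a,b,x\in S$. For $A,B\subseteq S$, $AB=\{ab: a\in A, b\in B\}$ (with $a$ in place of $\{a\}$), and $S^m=S\cdots S$ ($m$ factors) is the set of all products of $m$ elements of $S$. For $H\subseteq S$, $(H]=\{t\in S: t\leq h \text{ for some } h\in H\}$. Subsemigroups are understood to be non-empty. - $S$ is $m$-regular if $a\in(aS^ma]$ for all $a\in S$, i.e. for every $a\in S$ there is $x\in S^m$ with $a\leq axa$. - An $m$-left ideal of $S$ is a subsemigroup $L$ of $S$ with $S^mL\subseteq L$ and $(L]=L$; an $m$-right ideal is a subsemigroup $R$ with $RS^m\subseteq R$ and $(R]=R$. - An $m$-bi-interior ideal of $S$ is a non-empty subset $B$ of $S$ with $(BS^mB]\cap(S^mBS^m]\subseteq B$ and $(B]=B$. *)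

theory Defs
  imports Main "HOL-Library.Set_Algebras"
begin

text \<open>
  The ordered semigroup \<open>S\<close> is the universe of a type \<open>'a\<close>. Products of subsets \<open>A * B\<close> are those of
  \<^theory>\<open>HOL-Library.Set_Algebras\<close>.
\<close>

class ordered_semigroup_mult = semigroup_mult + order +
  assumes mult_left_compat: "a \<le> b \<Longrightarrow> x * a \<le> x * b"
    and mult_right_compat: "a \<le> b \<Longrightarrow> a * x \<le> b * x"

text \<open>
  \<open>set_power A m\<close> is the product of \<open>m\<close> copies of \<open>A\<close>. There is no unit, so the library power does
  not apply; the value at \<open>m = 0\<close> is a dummy.
\<close>

fun set_power :: "'a::semigroup_mult set \<Rightarrow> nat \<Rightarrow> 'a set" where
  "set_power A 0 = {}"
| "set_power A (Suc 0) = A"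
| "set_power A (Suc (Suc n)) = A * set_power A (Suc n)"

definition down_closure :: "'a::order set \<Rightarrow> 'a set" where
  "down_closure H = {t. \<exists>h\<in>H. t \<le> h}"

definition subsemigroup :: "'a::semigroup_mult set \<Rightarrow> bool" where
  "subsemigroup A \<longleftrightarrow> A \<noteq> {} \<and> (\<forall>a\<in>A. \<forall>b\<in>A. a * b \<in> A)"

definition m_regular :: "'a::ordered_semigroup_mult itself \<Rightarrow> nat \<Rightarrow> bool" where
  "m_regular _ m \<longleftrightarrow> (\<forall>a::'a. a \<in> down_closure ({a} * set_power UNIV m * {a}))"

definition m_left_ideal :: "nat \<Rightarrow> 'a::ordered_semigroup_mult set \<Rightarrow> bool" where
  "m_left_ideal m L \<longleftrightarrow> subsemigroup L \<and> set_power UNIV m * L \<subseteq> L \<and> down_closure L = L"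

definition m_right_ideal :: "nat \<Rightarrow> 'a::ordered_semigroup_mult set \<Rightarrow> bool" where
  "m_right_ideal m R \<longleftrightarrow> subsemigroup R \<and> R * set_power UNIV m \<subseteq> R \<and> down_closure R = R"

definition m_bi_interior_ideal :: "nat \<Rightarrow> 'a::ordered_semigroup_mult set \<Rightarrow> bool" where
  "m_bi_interior_ideal m B \<longleftrightarrow>
     B \<noteq> {} \<and>
     down_closure (B * set_power UNIV m * B)
       \<inter> down_closure (set_power UNIV m * B * set_power UNIV m) \<subseteq> B \<and>
     down_closure B = B"

end

theory Submission
  imports Defs
begin

text \<open>
  The set \<open>S\<^sup>m\<close> is a two-sided ideal of \<open>S\<close>. Hence \<open>r (l x r') l' \<in> R L\<close> for \<open>x \<in> S\<^sup>m\<close>, so that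
  \<open>B = (R L]\<close> already satisfies \<open>(B S\<^sup>m B] \<subseteq> B\<close>. Conversely, iterating \<open>b \<le> b y b\<close> gives
  \<open>b x c \<le> (b y) b (y b x c) \<in> S\<^sup>m B S\<^sup>m\<close>, so in an \<open>m\<close>-regular semigroup the second
  set in the definition of an \<open>m\<close>-bi-interior ideal \<open>B\<close> is redundant and \<open>B = (B S\<^sup>m B]\<close>; then
  \<open>R = (B S\<^sup>m]\<close> and \<open>L = (S\<^sup>m B]\<close> work.
\<close>

lemma down_closure_iff: "t \<in> down_closure H \<longleftrightarrow> (\<exists>h\<in>H. t \<le> h)"
  by (simp add: down_closure_def)

lemma down_closure_idem [simp]: "down_closure (down_closure H) = down_closure H"
  by (auto simp: down_closure_def intro: order_trans)

lemma mult_mono_ordered_semigroup: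
  fixes a b c d :: "'a::ordered_semigroup_mult"
  assumes "a \<le> b" "c \<le> d"
  shows "a * c \<le> b * d"
  using mult_right_compat[OF assms(1)] mult_left_compat[OF assms(2)] by (rule order_trans)

text \<open>The new factor \<open>x\<close> merges with the first of the \<open>m\<close> factors of
  \<open>p\<close>, so the number of factors does not grow.\<close>

lemma set_power_UNIV_absorb_left:
  fixes p :: "'a::semigroup_mult"
  assumes "p \<in> set_power UNIV m"
  shows "x * p \<in> set_power UNIV m"
  using assms
\<comment> \<open>For \<open>m = 0\<close> the premise is void because the dummy value is empty; for
  \<open>m = 1\<close> the set is all of S.\<close>
proof (cases "(UNIV :: 'a set, m)" rule: set_power.cases)
  case (3 A n)
  with assms obtain a q where "p = a * q" "q \<in> set_power UNIV (Suc n)"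
    by (auto elim: set_times_elim)
  then have "x * p \<in> UNIV * set_power UNIV (Suc n)"
    by (metis UNIV_I mult.assoc set_times_intro)
  with 3 show ?thesis
    by simp
qed auto

text \<open>The recursion peels factors off on the left, so \<open>x\<close> has to travel to the
  last factor; this takes induction instead of a case split.\<close>

lemma set_power_UNIV_absorb_right:
  fixes p :: "'a::semigroup_mult"
  assumes "p \<in> set_power UNIV m"
  shows "p * x \<in> set_power UNIV m"
  using assms
proof (induction "UNIV :: 'a set" m arbitrary: p rule: set_power.induct)
  case (3 n)
  from 3(2) obtain a q where "p = a * q" "q \<in> set_power UNIV (Suc n)"
    by (auto simp: set_times_def)
  with 3(1)[of q] show ?case
    by (auto simp: mult.assoc)
qed auto

lemma m_regularE:
  fixes a :: "'a::ordered_semigroup_mult"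
  assumes "m_regular TYPE('a) m"
  obtains y where "y \<in> set_power UNIV m" "a \<le> a * y * a"
proof -
  have "a \<in> down_closure ({a} * set_power UNIV m * {a})"
    using assms by (simp add: m_regular_def)
  then show thesis
    by (auto simp: down_closure_iff set_times_def intro: that)
qed

lemma m_right_ideal_generated:
  fixes B :: "'a::ordered_semigroup_mult set"
  assumes "B \<noteq> {}" "set_power (UNIV :: 'a set) m \<noteq> {}"
  shows "m_right_ideal m (down_closure (B * set_power UNIV m))"
    (is "m_right_ideal m ?R")
proof -
  \<comment> \<open>Absorbing every \<open>s\<close>, not only those in S^m, yields both closure
    under products and the ideal condition.\<close>
  have absorb: "r * s \<in> ?R" if "r \<in> ?R" for r s
  proof -
    from that obtain b p where "b \<in> B" "p \<in> set_power UNIV m" "r \<le> b * p"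
      by (auto simp: down_closure_iff set_times_def)
    moreover from this have "r * s \<le> b * (p * s)"
      using mult_right_compat[of r "b * p" s] by (simp add: mult.assoc)
    ultimately show ?thesis
      unfolding down_closure_iff by (blast intro: set_power_UNIV_absorb_right)
  qed
  obtain b p where "b \<in> B" "p \<in> set_power (UNIV :: 'a set) m"
    using assms by blast
  then have "b * p \<in> ?R"
    unfolding down_closure_iff by blast
  with absorb show ?thesis
    unfolding m_right_ideal_def subsemigroup_def by (auto elim!: set_times_elim)
qed

text \<open>The mirror image of \<open>m_right_ideal_generated\<close>: here \<open>p\<close>
  absorbs the new factor from the left.\<close>

lemma m_left_ideal_generated:
  fixes B :: "'a::ordered_semigroup_mult set"
  assumes "B \<noteq> {}" "set_power (UNIV :: 'a set) m \<noteq> {}"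
  shows "m_left_ideal m (down_closure (set_power UNIV m * B))"
    (is "m_left_ideal m ?L")
proof -
  have absorb: "s * l \<in> ?L" if "l \<in> ?L" for l s
  proof -
    from that obtain b p where "b \<in> B" "p \<in> set_power UNIV m" "l \<le> p * b"
      by (auto simp: down_closure_iff set_times_def)
    moreover from this have "s * l \<le> (s * p) * b"
      using mult_left_compat[of l "p * b" s] by (simp add: mult.assoc)
    ultimately show ?thesis
      unfolding down_closure_iff by (blast intro: set_power_UNIV_absorb_left)
  qed
  obtain b p where "b \<in> B" "p \<in> set_power (UNIV :: 'a set) m"
    using assms by blast
  then have "p * b \<in> ?L"
    unfolding down_closure_iff by blast
  with absorb show ?thesis
    unfolding m_left_ideal_def subsemigroup_def by (auto elim!: set_times_elim)
qed

lemma m_bi_interior_ideal_right_times_left: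
  fixes R L :: "'a::ordered_semigroup_mult set"
  assumes R: "m_right_ideal m R" and L: "m_left_ideal m L"
  shows "m_bi_interior_ideal m (down_closure (R * L))"
proof -
  let ?B = "down_closure (R * L)"
  obtain r l where "r \<in> R" "l \<in> L"
    using R L unfolding m_right_ideal_def m_left_ideal_def subsemigroup_def by blast
  then have ne: "?B \<noteq> {}"
    unfolding down_closure_def by blast
  have "t \<in> ?B" if t: "t \<in> down_closure (?B * set_power UNIV m * ?B)" for t
  proof -
    from t obtain b x c where bc: "b \<in> ?B" "c \<in> ?B" and x: "x \<in> set_power UNIV m"
      and t: "t \<le> b * x * c"
      by (auto simp: down_closure_iff[of t] elim!: set_times_elim)
    from bc obtain r l r' l' where rl: "r \<in> R" "l \<in> L" "b \<le> r * l"
      and rl': "r' \<in> R" "l' \<in> L" "c \<le> r' * l'"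
      by (auto simp: down_closure_iff elim!: set_times_elim)
    have "b * x * c \<le> (r * l) * x * (r' * l')"
      by (intro mult_mono_ordered_semigroup rl rl' order_refl)
    \<comment> \<open>Regrouping isolates \<open>l * x * r'\<close>, which inherits membership in
      S^m from \<open>x\<close>; \<open>R\<close> then swallows it and \<open>l'\<close> remains as
      the factor from \<open>L\<close>.\<close>
    with t have le: "t \<le> (r * (l * x * r')) * l'"
      by (simp add: mult.assoc)
    have "l * x * r' \<in> set_power UNIV m"
      by (intro set_power_UNIV_absorb_left set_power_UNIV_absorb_right x)
    with R rl(1) have "r * (l * x * r') \<in> R"
      unfolding m_right_ideal_def by blast
    with rl'(2) le show ?thesis
      unfolding down_closure_iff by blast
  qed
  with ne show ?thesis
    unfolding m_bi_interior_ideal_def by auto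
qed

lemma m_regular_bi_interior_ideal_eq:
  fixes B :: "'a::ordered_semigroup_mult set"
  assumes reg: "m_regular TYPE('a) m" and B: "m_bi_interior_ideal m B"
  shows "B = down_closure (down_closure (B * set_power UNIV m) * down_closure (set_power UNIV m * B))"
    (is "B = down_closure (?R * ?L)")
proof (intro equalityI subsetI)
  fix b assume b: "b \<in> B"
  obtain y where y: "y \<in> set_power UNIV m" "b \<le> b * y * b"
    using reg by (rule m_regularE)
  \<comment> \<open>Regularity is used twice so that the bound splits into \<open>b * y\<close> in B
    S^m and \<open>(b * y) * b\<close> in S^m B.\<close>
  have "b * y * b \<le> b * y * (b * y * b)"
    using y(2) by (rule mult_left_compat)
  with y(2) have le: "b \<le> (b * y) * (b * y * b)"
    by (rule order_trans)
  have "b * y \<in> ?R" "b * y * b \<in> ?L"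
    unfolding down_closure_iff
    using b y(1) by (blast intro: set_power_UNIV_absorb_left)+
  with le show "b \<in> down_closure (?R * ?L)"
    unfolding down_closure_iff[of b] by blast
next
  fix t assume "t \<in> down_closure (?R * ?L)"
  then obtain r l where r: "r \<in> ?R" and l: "l \<in> ?L" and t: "t \<le> r * l"
    by (auto simp: down_closure_iff[of t] elim!: set_times_elim)
  from r obtain b p where b: "b \<in> B" "p \<in> set_power UNIV m" "r \<le> b * p"
    by (auto simp: down_closure_iff elim!: set_times_elim)
  from l obtain c q where c: "c \<in> B" "q \<in> set_power UNIV m" "l \<le> q * c"
    by (auto simp: down_closure_iff elim!: set_times_elim)
  have "r * l \<le> (b * p) * (q * c)"
    by (intro mult_mono_ordered_semigroup b c)
  with t have le: "t \<le> b * (p * q) * c"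
    by (simp add: mult.assoc)
  have pq: "p * q \<in> set_power UNIV m"
    using c(2) by (rule set_power_UNIV_absorb_left)
  have 1: "t \<in> down_closure (B * set_power UNIV m * B)"
    unfolding down_closure_iff using le pq b(1) c(1) by blast
  obtain y where y: "y \<in> set_power UNIV m" "b \<le> b * y * b"
    using reg by (rule m_regularE)
  \<comment> \<open>The leading \<open>b\<close> of the bound \<open>b * (p * q) * c\<close> is
    expanded so that a copy of \<open>b\<close> stands strictly inside. Each flank contains a
    \<open>y\<close>, and absorption around it puts the whole flank into S^m.\<close>
  have "b * y * b \<le> b * y * (b * y * b)"
    using y(2) by (rule mult_left_compat)
  with y(2) have "b \<le> b * y * (b * y * b)"
    by (rule order_trans)
  from mult_right_compat[OF this, of "p * q * c"] le
  have le': "t \<le> (b * y) * b * (y * (b * (p * q) * c))"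
    by (simp add: mult.assoc)
  have "b * y \<in> set_power UNIV m" "y * (b * (p * q) * c) \<in> set_power UNIV m"
    using y(1) by (auto intro: set_power_UNIV_absorb_left set_power_UNIV_absorb_right)
  with le' b(1) have 2: "t \<in> down_closure (set_power UNIV m * B * set_power UNIV m)"
    unfolding down_closure_iff by blast
  from B 1 2 show "t \<in> B"
    unfolding m_bi_interior_ideal_def by blast
qed

theorem theorem2p10:
  fixes B :: "'a::ordered_semigroup_mult set" and m :: nat
  assumes "m \<ge> 1"
    and "m_regular TYPE('a) m"
    and "subsemigroup B"
  shows "(\<exists>R L. m_right_ideal m R \<and> m_left_ideal m L \<and> B = down_closure (R * L))
           \<longleftrightarrow> m_bi_interior_ideal m B"
proof
  assume "\<exists>R L. m_right_ideal m R \<and> m_left_ideal m L \<and> B = down_closure (R * L)"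
  then show "m_bi_interior_ideal m B"
    using m_bi_interior_ideal_right_times_left by blast
next
  assume B: "m_bi_interior_ideal m B"
  then have ne: "B \<noteq> {}"
    by (simp add: m_bi_interior_ideal_def)
  \<comment> \<open>Regularity at any single element supplies a member of S^m.\<close>
  have P: "set_power (UNIV :: 'a set) m \<noteq> {}"
    using m_regularE[OF assms(2)] by blast
  show "\<exists>R L. m_right_ideal m R \<and> m_left_ideal m L \<and> B = down_closure (R * L)"
    using m_right_ideal_generated[OF ne P] m_left_ideal_generated[OF ne P]
      m_regular_bi_interior_ideal_eq[OF assms(2) B]
    by (intro exI conjI)
qed

end
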